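(* Let $\phi\bullet\psi$ be a product or skew-product dynamical system on $X\times Y$ with base system $\psi$ on $Y$, where $X,Y$ are nonempty compact metric spaces, and let $\pi_Y\colon X\times Y\to Y$ be the projection. Define $$\hat\iota_Y\colon\mathsf{ANbhd}(\psi)\to\mathsf{ANbhd}(\phi\bullet\psi),\ \hat\iota_Y(U)=X\times U,\qquad \iota_Y\colon\mathsf{Att}(\psi)\to\mathsf{Att}(\phi\bullet\psi),\ \iota_Y(A)=\mathrm{Inv}(X\times A).$$ Then $\hat\iota_Y$ and $\iota_Y$ are lattice embeddings (injective lattice homomorphisms). Moreover, with $\pi_Y$ acting on sets by taking images, $\pi_Y\circ\hat\iota_Y=\mathrm{id}_{\mathsf{ANbhd}(\psi)}$ and $\pi_Y\circ\iota_Y=\mathrm{id}_{\mathsf{Att}(\psi)}$.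
   Context: $\mathbb{T}$ is $\mathbb{Z}$ or $\mathbb{R}$, $\mathbb{T}^+$ its nonnegative part. A dynamical system on a compact metric space $Z$ is a continuous map $\theta\colon\mathbb{T}^+\times Z\to Z$ with $\theta(0,z)=z$, $\theta(t,\theta(s,z))=\theta(t+s,z)$ (not assumed injective or surjective). Product system: for dynamical systems $\phi$ on $X$ and $\psi$ on $Y$, $(\phi\times\psi)(t,(x,y))=(\phi(t,x),\psi(t,y))$. Skew-product system: $(\phi\rtimes\psi)(t,(x,y))=(\phi(t,x,y),\psi(t,y))$ where $\psi$ is a dynamical system on $Y$ and $\phi\colon\mathbb{T}^+\times X\times Y\to X$ is continuous with $\phi(0,x,y)=x$ and $\phi(t+s,x,y)=\phi(t,\phi(s,x,y),\psi(s,y))$. $\phi\bullet\psi$ denotes either. $S$ is invariant if $\theta(t,S)=S$ for all $t\ge0$; $\mathrm{Inv}(U)$ is the union of all invariant subsets of $U$. $\omega(U)=\bigcap_{t\ge0}\mathrm{cl}(\theta([t,\infty),U))$. $U\subset Z$ is an attracting neighborhood if there is $\tau>0$ with $\theta(t,\mathrm{cl}(U))\subset\mathrm{int}(U)$ for all $t\ge\tau$; an attractor is $\omega(U)$ ($=\mathrm{Inv}(U)$) for an attracting neighborhood $U$. $\mathsf{ANbhd}(\theta)$ is the bounded distributive lattice of attracting neighborhoods with $\vee=\cup$, $\wedge=\cap$; $\mathsf{Att}(\theta)$ is the bounded distributive lattice of attractors with $\vee=\cup$, $A\wedge B=\omega(A\cap B)$, minimum $\emptyset$, maximum $\mathrm{Inv}(Z)$.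 Lattice homomorphisms preserve minimum and maximum. *)

theory Defs
  imports "HOL-Analysis.Analysis"
begin

text \<open>
  The time domain is a set \<open>T\<close> of reals, which the theorem takes to be \<open>\<int>\<close> or \<open>UNIV\<close>; the subspace
  topology of \<open>\<int>\<close> in the reals is the discrete one. Systems are total functions of a real time, and
  only their values at times in \<open>Tplus T\<close> are ever referred to.
\<close>

definition Tplus :: "real set \<Rightarrow> real set" where
  "Tplus T = {t \<in> T. 0 \<le> t}"

definition dynamical_system :: "real set \<Rightarrow> (real \<Rightarrow> 'z::metric_space \<Rightarrow> 'z) \<Rightarrow> bool" where
  "dynamical_system T \<theta> \<longleftrightarrow>
     continuous_on (Tplus T \<times> UNIV) (\<lambda>(t, z). \<theta> t z) \<and>
     (\<forall>z. \<theta> 0 z = z) \<and>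
     (\<forall>t\<in>Tplus T. \<forall>s\<in>Tplus T. \<forall>z. \<theta> t (\<theta> s z) = \<theta> (t + s) z)"

definition product_system ::
    "(real \<Rightarrow> 'x \<Rightarrow> 'x) \<Rightarrow> (real \<Rightarrow> 'y \<Rightarrow> 'y) \<Rightarrow> real \<Rightarrow> 'x \<times> 'y \<Rightarrow> 'x \<times> 'y" where
  "product_system \<phi> \<psi> t = (\<lambda>(x, y). (\<phi> t x, \<psi> t y))"

definition skew_cocycle ::
    "real set \<Rightarrow> (real \<Rightarrow> 'x::metric_space \<Rightarrow> 'y::metric_space \<Rightarrow> 'x) \<Rightarrow> (real \<Rightarrow> 'y \<Rightarrow> 'y) \<Rightarrow> bool" where
  "skew_cocycle T \<phi> \<psi> \<longleftrightarrow>
     continuous_on (Tplus T \<times> UNIV \<times> UNIV) (\<lambda>(t, x, y). \<phi> t x y) \<and>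
     (\<forall>x y. \<phi> 0 x y = x) \<and>
     (\<forall>t\<in>Tplus T. \<forall>s\<in>Tplus T. \<forall>x y. \<phi> (t + s) x y = \<phi> t (\<phi> s x y) (\<psi> s y))"

definition skew_product_system ::
    "(real \<Rightarrow> 'x \<Rightarrow> 'y \<Rightarrow> 'x) \<Rightarrow> (real \<Rightarrow> 'y \<Rightarrow> 'y) \<Rightarrow> real \<Rightarrow> 'x \<times> 'y \<Rightarrow> 'x \<times> 'y" where
  "skew_product_system \<phi> \<psi> t = (\<lambda>(x, y). (\<phi> t x y, \<psi> t y))"

definition product_or_skew_product ::
    "real set \<Rightarrow> (real \<Rightarrow> 'y::metric_space \<Rightarrow> 'y) \<Rightarrow> (real \<Rightarrow> 'x::metric_space \<times> 'y \<Rightarrow> 'x \<times> 'y) \<Rightarrow> bool" where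
  "product_or_skew_product T \<psi> \<Theta> \<longleftrightarrow>
     dynamical_system T \<psi> \<and>
     ((\<exists>\<phi>. dynamical_system T \<phi> \<and> \<Theta> = product_system \<phi> \<psi>) \<or>
      (\<exists>\<phi>. skew_cocycle T \<phi> \<psi> \<and> \<Theta> = skew_product_system \<phi> \<psi>))"

definition invariant_set :: "real set \<Rightarrow> (real \<Rightarrow> 'z \<Rightarrow> 'z) \<Rightarrow> 'z set \<Rightarrow> bool" where
  "invariant_set T \<theta> S \<longleftrightarrow> (\<forall>t\<in>Tplus T. \<theta> t ` S = S)"

definition Inv_set :: "real set \<Rightarrow> (real \<Rightarrow> 'z \<Rightarrow> 'z) \<Rightarrow> 'z set \<Rightarrow> 'z set" where
  "Inv_set T \<theta> U = \<Union>{S. S \<subseteq> U \<and> invariant_set T \<theta> S}"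

definition omega_limit :: "real set \<Rightarrow> (real \<Rightarrow> 'z::metric_space \<Rightarrow> 'z) \<Rightarrow> 'z set \<Rightarrow> 'z set" where
  "omega_limit T \<theta> U = (\<Inter>t\<in>Tplus T. closure (\<Union>s\<in>{s\<in>T. t \<le> s}. \<theta> s ` U))"

definition attracting_nbhd :: "real set \<Rightarrow> (real \<Rightarrow> 'z::metric_space \<Rightarrow> 'z) \<Rightarrow> 'z set \<Rightarrow> bool" where
  "attracting_nbhd T \<theta> U \<longleftrightarrow>
     (\<exists>\<tau>\<in>T. \<tau> > 0 \<and> (\<forall>t\<in>T. t \<ge> \<tau> \<longrightarrow> \<theta> t ` closure U \<subseteq> interior U))"

definition attractor :: "real set \<Rightarrow> (real \<Rightarrow> 'z::metric_space \<Rightarrow> 'z) \<Rightarrow> 'z set \<Rightarrow> bool" where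
  "attractor T \<theta> A \<longleftrightarrow> (\<exists>U. attracting_nbhd T \<theta> U \<and> A = omega_limit T \<theta> U)"

text \<open>
  Bounded lattices on a carrier with explicitly given operations. The meet of attractors is not the
  intersection, so the operations are data rather than read off from the ambient powerset.
\<close>

record 'a bdd_lat =
  lcarrier :: "'a set"
  ljoin :: "'a \<Rightarrow> 'a \<Rightarrow> 'a"
  lmeet :: "'a \<Rightarrow> 'a \<Rightarrow> 'a"
  lmin :: 'a
  lmax :: 'a

definition bounded_distrib_lattice :: "'a bdd_lat \<Rightarrow> bool" where
  "bounded_distrib_lattice L \<longleftrightarrow>
     lmin L \<in> lcarrier L \<and> lmax L \<in> lcarrier L \<and>
     (\<forall>a\<in>lcarrier L. \<forall>b\<in>lcarrier L.
        ljoin L a b \<in> lcarrier L \<and> lmeet L a b \<in> lcarrier L \<and>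
        ljoin L a b = ljoin L b a \<and> lmeet L a b = lmeet L b a \<and>
        ljoin L a (lmeet L a b) = a \<and> lmeet L a (ljoin L a b) = a) \<and>
     (\<forall>a\<in>lcarrier L. \<forall>b\<in>lcarrier L. \<forall>c\<in>lcarrier L.
        ljoin L a (ljoin L b c) = ljoin L (ljoin L a b) c \<and>
        lmeet L a (lmeet L b c) = lmeet L (lmeet L a b) c \<and>
        lmeet L a (ljoin L b c) = ljoin L (lmeet L a b) (lmeet L a c)) \<and>
     (\<forall>a\<in>lcarrier L. ljoin L (lmin L) a = a \<and> lmeet L (lmax L) a = a)"

definition lattice_homomorphism :: "'a bdd_lat \<Rightarrow> 'b bdd_lat \<Rightarrow> ('a \<Rightarrow> 'b) \<Rightarrow> bool" where
  "lattice_homomorphism L M f \<longleftrightarrow>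
     bounded_distrib_lattice L \<and> bounded_distrib_lattice M \<and>
     f ` lcarrier L \<subseteq> lcarrier M \<and>
     (\<forall>a\<in>lcarrier L. \<forall>b\<in>lcarrier L.
        f (ljoin L a b) = ljoin M (f a) (f b) \<and> f (lmeet L a b) = lmeet M (f a) (f b)) \<and>
     f (lmin L) = lmin M \<and> f (lmax L) = lmax M"

definition lattice_embedding :: "'a bdd_lat \<Rightarrow> 'b bdd_lat \<Rightarrow> ('a \<Rightarrow> 'b) \<Rightarrow> bool" where
  "lattice_embedding L M f \<longleftrightarrow> lattice_homomorphism L M f \<and> inj_on f (lcarrier L)"

definition ANbhd :: "real set \<Rightarrow> (real \<Rightarrow> 'z::metric_space \<Rightarrow> 'z) \<Rightarrow> 'z set bdd_lat" where
  "ANbhd T \<theta> = \<lparr>lcarrier = {U. attracting_nbhd T \<theta> U}, ljoin = (\<union>), lmeet = (\<inter>),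
                lmin = {}, lmax = UNIV\<rparr>"

definition Att :: "real set \<Rightarrow> (real \<Rightarrow> 'z::metric_space \<Rightarrow> 'z) \<Rightarrow> 'z set bdd_lat" where
  "Att T \<theta> = \<lparr>lcarrier = {A. attractor T \<theta> A}, ljoin = (\<union>),
              lmeet = (\<lambda>A B. omega_limit T \<theta> (A \<inter> B)),
              lmin = {}, lmax = Inv_set T \<theta> UNIV\<rparr>"

definition iota_hat :: "'y set \<Rightarrow> ('x \<times> 'y) set" where
  "iota_hat U = UNIV \<times> U"

definition iota :: "real set \<Rightarrow> (real \<Rightarrow> 'x \<times> 'y \<Rightarrow> 'x \<times> 'y) \<Rightarrow> 'y set \<Rightarrow> ('x \<times> 'y) set" where
  "iota T \<Theta> A = Inv_set T \<Theta> (UNIV \<times> A)"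

end

theory Submission
  imports Defs
begin

text \<open>
  Everything follows from the fact that the projection of a product or skew product to its base is a
  \<^emph>\<open>factor map\<close>, a continuous surjection \<open>\<pi>\<close> with \<open>\<pi> \<circ> \<Theta> t = \<psi> t \<circ> \<pi>\<close> for times \<open>t \<ge> 0\<close>, and that
  \<open>UNIV \<times> U\<close> is the preimage of \<open>U\<close>.

  Preimages under \<open>\<pi>\<close> commute with unions and intersections and, by continuity alone, take attracting
  neighborhoods to attracting neighborhoods; as \<open>\<pi>\<close> is onto, images undo them. This settles
  neighborhoods.

  For attractors, the bridge is that every invariant set upstairs projects to an invariant set. If
  \<open>U\<close> is an attracting neighborhood of \<open>A\<close>, the invariant subsets of the preimage of \<open>A\<close> are
  therefore those of the preimage of \<open>U\<close>, so that lifting the attractor of \<open>U\<close> gives the attractor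
  of the preimage of \<open>U\<close> (\<open>lift_omega_limit\<close>). The homomorphism laws are thereby inherited from
  those for neighborhoods, because \<open>U \<mapsto> \<omega>(U)\<close> turns the lattice operations on attracting
  neighborhoods into those on attractors (\<open>omega_limit_Un\<close>, \<open>omega_limit_Int\<close>).

  What remains is that the lift of \<open>A\<close> projects onto all of \<open>A\<close>, which also gives injectivity. Each
  \<open>y \<in> A\<close> has preimages in \<open>A\<close> under \<open>\<psi> t\<close> for all \<open>t\<close>; lifting these and flowing forward gives points
  over \<open>y\<close> that come from arbitrarily long orbits in the preimage of \<open>A\<close>, and compactness gives a
  point over \<open>y\<close> in the limit. The same compactness principle (\<open>omega_limit_meets_closed\<close>) shows that
  omega-limit sets are invariant in the first place.
\<close>

section \<open>Omega-limit sets and attractors in a compact space\<close>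

lemma Inv_set_mono: "U \<subseteq> V \<Longrightarrow> Inv_set T \<theta> U \<subseteq> Inv_set T \<theta> V"
  by (auto simp: Inv_set_def)

lemma Inv_set_subset: "Inv_set T \<theta> U \<subseteq> U"
  by (auto simp: Inv_set_def)

lemma invariant_subset_Inv_set: "invariant_set T \<theta> S \<Longrightarrow> S \<subseteq> U \<Longrightarrow> S \<subseteq> Inv_set T \<theta> U"
  by (auto simp: Inv_set_def)

lemma invariant_Inv_set: "invariant_set T \<theta> (Inv_set T \<theta> U)"
  unfolding invariant_set_def
proof
  fix t assume "t \<in> Tplus T"
  then have "(\<lambda>S. \<theta> t ` S) ` {S. S \<subseteq> U \<and> invariant_set T \<theta> S} = {S. S \<subseteq> U \<and> invariant_set T \<theta> S}"
    by (force simp: invariant_set_def)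
  then show "\<theta> t ` Inv_set T \<theta> U = Inv_set T \<theta> U"
    unfolding Inv_set_def image_Union by simp
qed

definition tail :: "real set \<Rightarrow> (real \<Rightarrow> 'z \<Rightarrow> 'z) \<Rightarrow> 'z set \<Rightarrow> real \<Rightarrow> 'z set" where
  "tail T \<theta> U t = (\<Union>s\<in>{s\<in>T. t \<le> s}. \<theta> s ` U)"

lemma omega_limit_tail: "omega_limit T \<theta> U = (\<Inter>t\<in>Tplus T. closure (tail T \<theta> U t))"
  by (simp add: omega_limit_def tail_def)

lemma tail_antimono: "s \<le> t \<Longrightarrow> tail T \<theta> U t \<subseteq> tail T \<theta> U s"
  by (force simp: tail_def)

lemma omega_limit_mono: "U \<subseteq> V \<Longrightarrow> omega_limit T \<theta> U \<subseteq> omega_limit T \<theta> V"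
proof -
  assume "U \<subseteq> V"
  then have "closure (tail T \<theta> U t) \<subseteq> closure (tail T \<theta> V t)" for t
    by (intro closure_mono) (auto simp: tail_def)
  then show ?thesis unfolding omega_limit_tail by blast
qed

lemma omega_limit_empty: "0 \<in> T \<Longrightarrow> omega_limit T \<theta> {} = {}"
  by (auto simp: omega_limit_def Tplus_def)

lemma closed_omega_limit: "closed (omega_limit T \<theta> U)"
  by (auto simp: omega_limit_def)

lemma omega_limit_Un: "omega_limit T \<theta> (U \<union> V) = omega_limit T \<theta> U \<union> omega_limit T \<theta> V"
proof
  show "omega_limit T \<theta> (U \<union> V) \<subseteq> omega_limit T \<theta> U \<union> omega_limit T \<theta> V"
  proof
    fix z assume z: "z \<in> omega_limit T \<theta> (U \<union> V)"
    show "z \<in> omega_limit T \<theta> U \<union> omega_limit T \<theta> V"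
    proof (rule ccontr)
      assume "\<not> ?thesis"
      then obtain s t where s: "s \<in> Tplus T" "z \<notin> closure (tail T \<theta> U s)"
        and t: "t \<in> Tplus T" "z \<notin> closure (tail T \<theta> V t)"
        unfolding omega_limit_tail by blast
      \<comment> \<open>Beyond the later of the two times, the orbits from both sets avoid \<open>z\<close>.\<close>
      have "tail T \<theta> (U \<union> V) (max s t) \<subseteq> tail T \<theta> U s \<union> tail T \<theta> V t"
        by (auto simp: tail_def)
      moreover have "max s t \<in> Tplus T"
        using s t by (simp add: max_def)
      ultimately have "z \<in> closure (tail T \<theta> U s \<union> tail T \<theta> V t)"
        using z closure_mono unfolding omega_limit_tail by blast
      then show False using s t by (simp add: closure_Un)
    qed
  qed
qed (simp add: omega_limit_mono)

lemma attracting_nbhd_Un: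
  assumes "attracting_nbhd T \<theta> U" and "attracting_nbhd T \<theta> V"
  shows "attracting_nbhd T \<theta> (U \<union> V)"
proof -
  obtain s where s: "s \<in> T" "s > 0" "\<And>t. t \<in> T \<Longrightarrow> t \<ge> s \<Longrightarrow> \<theta> t ` closure U \<subseteq> interior U"
    using assms(1) by (auto simp: attracting_nbhd_def)
  obtain r where r: "r \<in> T" "r > 0" "\<And>t. t \<in> T \<Longrightarrow> t \<ge> r \<Longrightarrow> \<theta> t ` closure V \<subseteq> interior V"
    using assms(2) by (auto simp: attracting_nbhd_def)
  have "\<theta> t ` closure (U \<union> V) \<subseteq> interior (U \<union> V)" if "t \<in> T" "t \<ge> max s r" for t
  proof -
    have "interior U \<union> interior V \<subseteq> interior (U \<union> V)"
      by (simp add: interior_mono)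
    moreover have "\<theta> t ` closure U \<subseteq> interior U" "\<theta> t ` closure V \<subseteq> interior V"
      using s(3)[of t] r(3)[of t] that by auto
    ultimately show ?thesis unfolding closure_Un image_Un by blast
  qed
  moreover have "max s r \<in> T" "max s r > 0" using s r by (auto simp: max_def)
  ultimately show ?thesis unfolding attracting_nbhd_def by blast
qed

lemma attracting_nbhd_Int:
  assumes "attracting_nbhd T \<theta> U" and "attracting_nbhd T \<theta> V"
  shows "attracting_nbhd T \<theta> (U \<inter> V)"
proof -
  obtain s where s: "s \<in> T" "s > 0" "\<And>t. t \<in> T \<Longrightarrow> t \<ge> s \<Longrightarrow> \<theta> t ` closure U \<subseteq> interior U"
    using assms(1) by (auto simp: attracting_nbhd_def)
  obtain r where r: "r \<in> T" "r > 0" "\<And>t. t \<in> T \<Longrightarrow> t \<ge> r \<Longrightarrow> \<theta> t ` closure V \<subseteq> interior V"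
    using assms(2) by (auto simp: attracting_nbhd_def)
  have "\<theta> t ` closure (U \<inter> V) \<subseteq> interior (U \<inter> V)" if "t \<in> T" "t \<ge> max s r" for t
  proof -
    have "closure (U \<inter> V) \<subseteq> closure U \<inter> closure V"
      by (simp add: closure_mono)
    then have "\<theta> t ` closure (U \<inter> V) \<subseteq> interior U \<inter> interior V"
      using s(3)[of t] r(3)[of t] that by (simp add: image_subset_iff) blast
    then show ?thesis by (simp add: interior_Int)
  qed
  moreover have "max s r \<in> T" "max s r > 0" using s r by (auto simp: max_def)
  ultimately show ?thesis unfolding attracting_nbhd_def by blast
qed

locale compact_system =
  fixes T :: "real set" and \<theta> :: "real \<Rightarrow> 'z::metric_space \<Rightarrow> 'z"
  assumes time: "T = \<int> \<or> T = UNIV"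
    and compact_space: "compact (UNIV :: 'z set)"
    and system: "dynamical_system T \<theta>"
begin

lemma time_facts:
  "0 \<in> T" "1 \<in> T" "real n \<in> T" "s \<in> T \<Longrightarrow> t \<in> T \<Longrightarrow> s + t \<in> T" "s \<in> T \<Longrightarrow> t \<in> T \<Longrightarrow> s - t \<in> T"
  using time by auto

lemma flow_add: "s \<in> Tplus T \<Longrightarrow> t \<in> Tplus T \<Longrightarrow> \<theta> t (\<theta> s z) = \<theta> (t + s) z"
  using system by (auto simp: dynamical_system_def)

lemma continuous_flow:
  assumes "t \<in> Tplus T"
  shows "continuous_on UNIV (\<theta> t)"
proof -
  have "continuous_on (Tplus T \<times> UNIV) (\<lambda>(t, z). \<theta> t z)"
    using system by (simp add: dynamical_system_def)
  then have "continuous_on UNIV (\<lambda>z. (\<lambda>(t, z). \<theta> t z) (t, z))"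
    by (rule continuous_on_compose2) (auto intro!: continuous_intros simp: assms)
  then show ?thesis by simp
qed

lemma compact_closure: "compact (closure (S :: 'z set))"
  using closed_Int_compact[OF closed_closure compact_space] by simp

text \<open>
  Integer times are cofinal, so the omega-limit set is the intersection of a decreasing sequence
  of closed sets, and intersecting each with \<open>C\<close> leaves nonempty sets with the finite intersection property.
\<close>
lemma omega_limit_meets_closed:
  assumes "closed C" and meets: "\<And>n::nat. C \<inter> closure (tail T \<theta> U (real n)) \<noteq> {}"
  shows "C \<inter> omega_limit T \<theta> U \<noteq> {}"
proof -
  let ?K = "\<lambda>n::nat. C \<inter> closure (tail T \<theta> U (real n))"
  have "UNIV \<inter> \<Inter>(range ?K) \<noteq> {}"
  proof (rule compact_imp_fip_image[OF compact_space])
    show "closed (?K n)" for n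
      using assms(1) by auto
    fix I :: "nat set" assume "finite I"
    then obtain N where "\<forall>n\<in>I. n \<le> N"
      unfolding finite_nat_set_iff_bounded_le by blast
    then have "?K N \<subseteq> ?K n" if "n \<in> I" for n
      using closure_mono[OF tail_antimono[of "real n" "real N" T \<theta> U]] that by auto
    then have "?K N \<subseteq> UNIV \<inter> \<Inter>(?K ` I)" by blast
    then show "UNIV \<inter> \<Inter>(?K ` I) \<noteq> {}"
      using meets[of N] by blast
  qed
  then obtain z where z: "z \<in> C" "\<And>n. z \<in> closure (tail T \<theta> U (real n))" by auto
  have "z \<in> closure (tail T \<theta> U t)" for t
    using z(2) closure_mono[OF tail_antimono] real_arch_simple[of t] by blast
  then show ?thesis using z(1) by (auto simp: omega_limit_tail)
qed

lemma flow_tail_subset: "t \<in> Tplus T \<Longrightarrow> r \<ge> 0 \<Longrightarrow> \<theta> t ` tail T \<theta> U r \<subseteq> tail T \<theta> U r"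
proof
  fix z assume t: "t \<in> Tplus T" and r: "r \<ge> 0" and "z \<in> \<theta> t ` tail T \<theta> U r"
  then obtain s u where s: "s \<in> T" "r \<le> s" "u \<in> U" "z = \<theta> t (\<theta> s u)"
    by (auto simp: tail_def)
  then have "z = \<theta> (t + s) u"
    using t r by (subst s(4), intro flow_add) (auto simp: Tplus_def)
  moreover have "t + s \<in> T" "r \<le> t + s"
    using t s time_facts by (auto simp: Tplus_def)
  ultimately show "z \<in> tail T \<theta> U r"
    using s by (auto simp: tail_def)
qed

lemma tail_add_subset:
  assumes "t \<in> Tplus T" and "r \<ge> 0"
  shows "tail T \<theta> U (r + t) \<subseteq> \<theta> t ` tail T \<theta> U r"
proof
  fix z assume "z \<in> tail T \<theta> U (r + t)"
  then obtain s u where s: "s \<in> T" "r + t \<le> s" "u \<in> U" "z = \<theta> s u"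
    by (auto simp: tail_def)
  have st: "s - t \<in> T" "r \<le> s - t"
    using assms s time_facts by (auto simp: Tplus_def)
  then have "\<theta> t (\<theta> (s - t) u) = \<theta> (t + (s - t)) u"
    using assms by (intro flow_add) (auto simp: Tplus_def)
  then have "z = \<theta> t (\<theta> (s - t) u)" using s by simp
  moreover have "\<theta> (s - t) u \<in> tail T \<theta> U r"
    using st s by (auto simp: tail_def)
  ultimately show "z \<in> \<theta> t ` tail T \<theta> U r" by blast
qed

text \<open>
  Forward invariance is continuity. For the converse, a point \<open>z\<close> of the omega-limit set is a limit
  of points on late orbits; going back by \<open>t\<close> along these orbits shows that the fibre of \<open>\<theta> t\<close> over
  \<open>z\<close> meets the closure of every tail.
\<close>
lemma invariant_omega_limit: "invariant_set T \<theta> (omega_limit T \<theta> U)"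
  unfolding invariant_set_def
proof
  fix t assume t: "t \<in> Tplus T"
  show "\<theta> t ` omega_limit T \<theta> U = omega_limit T \<theta> U"
  proof
    have "\<theta> t ` closure (tail T \<theta> U r) \<subseteq> closure (tail T \<theta> U r)" if "r \<in> Tplus T" for r
    proof (rule image_closure_subset)
      show "continuous_on (closure (tail T \<theta> U r)) (\<theta> t)"
        using continuous_flow[OF t] continuous_on_subset by blast
      show "\<theta> t ` tail T \<theta> U r \<subseteq> closure (tail T \<theta> U r)"
        using flow_tail_subset[OF t, of r U] that closure_subset by (fastforce simp: Tplus_def)
    qed simp
    then show "\<theta> t ` omega_limit T \<theta> U \<subseteq> omega_limit T \<theta> U"
      unfolding omega_limit_tail by blast
  next
    show "omega_limit T \<theta> U \<subseteq> \<theta> t ` omega_limit T \<theta> U"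
    proof
      fix z assume z: "z \<in> omega_limit T \<theta> U"
      have "\<theta> t -` {z} \<inter> omega_limit T \<theta> U \<noteq> {}"
      proof (rule omega_limit_meets_closed)
        show "closed (\<theta> t -` {z})"
          using continuous_flow[OF t] by (intro closed_vimage) auto
        fix n :: nat
        have "closed (\<theta> t ` closure (tail T \<theta> U (real n)))"
          using compact_closure continuous_flow[OF t]
          by (metis compact_continuous_image compact_imp_closed continuous_on_subset subset_UNIV)
        moreover have "tail T \<theta> U (real n + t) \<subseteq> \<theta> t ` closure (tail T \<theta> U (real n))"
          using tail_add_subset[OF t, of "real n" U]
            closure_subset[of "tail T \<theta> U (real n)"] by auto
        ultimately have "closure (tail T \<theta> U (real n + t)) \<subseteq> \<theta> t ` closure (tail T \<theta> U (real n))"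
          by (rule closure_minimal[rotated])
        moreover have "real n + t \<in> Tplus T"
          using t time_facts by (auto simp: Tplus_def)
        ultimately show "\<theta> t -` {z} \<inter> closure (tail T \<theta> U (real n)) \<noteq> {}"
          using z unfolding omega_limit_tail by blast
      qed
      then show "z \<in> \<theta> t ` omega_limit T \<theta> U" by blast
    qed
  qed
qed

lemma invariant_subset_omega_limit:
  assumes "invariant_set T \<theta> S" and "S \<subseteq> U"
  shows "S \<subseteq> omega_limit T \<theta> U"
proof -
  have "S \<subseteq> tail T \<theta> U t" if "t \<in> Tplus T" for t
  proof -
    have "S = \<theta> t ` S" using assms(1) that by (auto simp: invariant_set_def)
    also have "\<dots> \<subseteq> tail T \<theta> U t"
      using assms(2) that by (force simp: tail_def Tplus_def)
    finally show ?thesis .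
  qed
  then show ?thesis
    unfolding omega_limit_tail using closure_subset by blast
qed

lemma omega_limit_eq_Inv_set:
  assumes "omega_limit T \<theta> U \<subseteq> U"
  shows "omega_limit T \<theta> U = Inv_set T \<theta> U"
proof
  show "omega_limit T \<theta> U \<subseteq> Inv_set T \<theta> U"
    using invariant_omega_limit assms by (rule invariant_subset_Inv_set)
  show "Inv_set T \<theta> U \<subseteq> omega_limit T \<theta> U"
    using invariant_Inv_set Inv_set_subset by (rule invariant_subset_omega_limit)
qed

lemma omega_limit_forward_invariant:
  assumes "closed U" and "\<And>t. t \<in> Tplus T \<Longrightarrow> \<theta> t ` U \<subseteq> U"
  shows "omega_limit T \<theta> U = Inv_set T \<theta> U"
proof (rule omega_limit_eq_Inv_set)
  have "tail T \<theta> U 0 \<subseteq> U"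
    using assms(2) by (force simp: tail_def Tplus_def)
  then have "closure (tail T \<theta> U 0) \<subseteq> U"
    using assms(1) by (rule closure_minimal)
  then show "omega_limit T \<theta> U \<subseteq> U"
    using time_facts by (auto simp: omega_limit_tail Tplus_def)
qed

text \<open>
  Late orbits from \<open>U\<close> stay in \<open>U\<close>, so the omega-limit set lies in the closure of \<open>U\<close>; by invariance
  it equals its own image at a late time, which the attracting property puts inside \<open>U\<close>.
\<close>
lemma omega_limit_attracting_nbhd:
  assumes "attracting_nbhd T \<theta> U"
  shows "omega_limit T \<theta> U = Inv_set T \<theta> U"
proof (rule omega_limit_eq_Inv_set)
  obtain \<tau> where \<tau>: "\<tau> \<in> T" "\<tau> > 0"
    and attr: "\<And>t. t \<in> T \<Longrightarrow> t \<ge> \<tau> \<Longrightarrow> \<theta> t ` closure U \<subseteq> interior U"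
    using assms by (auto simp: attracting_nbhd_def)
  have T: "\<tau> \<in> Tplus T" using \<tau> by (simp add: Tplus_def)
  have "tail T \<theta> U \<tau> \<subseteq> U"
    using attr closure_subset[of U] interior_subset[of U] unfolding tail_def by blast
  then have "omega_limit T \<theta> U \<subseteq> closure U"
    using closure_mono T unfolding omega_limit_tail by blast
  moreover have "omega_limit T \<theta> U = \<theta> \<tau> ` omega_limit T \<theta> U"
    using invariant_omega_limit T by (auto simp: invariant_set_def)
  ultimately show "omega_limit T \<theta> U \<subseteq> U"
    using attr[OF \<tau>(1)] interior_subset[of U] by blast
qed

lemma omega_limit_Int:
  assumes "attracting_nbhd T \<theta> U" and "attracting_nbhd T \<theta> V"
  shows "omega_limit T \<theta> (omega_limit T \<theta> U \<inter> omega_limit T \<theta> V) = omega_limit T \<theta> (U \<inter> V)"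
proof
  have "omega_limit T \<theta> U \<inter> omega_limit T \<theta> V \<subseteq> U \<inter> V"
    unfolding omega_limit_attracting_nbhd[OF assms(1)] omega_limit_attracting_nbhd[OF assms(2)]
    by (intro Int_mono Inv_set_subset)
  then show "omega_limit T \<theta> (omega_limit T \<theta> U \<inter> omega_limit T \<theta> V) \<subseteq> omega_limit T \<theta> (U \<inter> V)"
    by (rule omega_limit_mono)
  show "omega_limit T \<theta> (U \<inter> V) \<subseteq> omega_limit T \<theta> (omega_limit T \<theta> U \<inter> omega_limit T \<theta> V)"
    by (intro invariant_subset_omega_limit invariant_omega_limit Int_greatest omega_limit_mono) auto
qed

lemma attracting_nbhd_empty: "attracting_nbhd T \<theta> {}"
  and attracting_nbhd_UNIV: "attracting_nbhd T \<theta> UNIV"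
  using time_facts by (auto simp: attracting_nbhd_def intro!: bexI[of _ 1])

lemma bounded_distrib_lattice_ANbhd: "bounded_distrib_lattice (ANbhd T \<theta>)"
  unfolding bounded_distrib_lattice_def ANbhd_def
  by (auto simp: attracting_nbhd_empty attracting_nbhd_UNIV attracting_nbhd_Un attracting_nbhd_Int)

lemma attractorE:
  assumes "attractor T \<theta> A"
  obtains U where "attracting_nbhd T \<theta> U" and "A = omega_limit T \<theta> U"
  using assms by (auto simp: attractor_def)

lemma closed_attractor: "attractor T \<theta> A \<Longrightarrow> closed A"
  and invariant_attractor: "attractor T \<theta> A \<Longrightarrow> invariant_set T \<theta> A"
  by (auto elim!: attractorE simp: closed_omega_limit invariant_omega_limit)

lemma omega_limit_attractor: "attractor T \<theta> A \<Longrightarrow> omega_limit T \<theta> A = A"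
proof -
  assume A: "attractor T \<theta> A"
  have "omega_limit T \<theta> A = Inv_set T \<theta> A"
    using closed_attractor[OF A] invariant_attractor[OF A]
    by (intro omega_limit_forward_invariant) (auto simp: invariant_set_def)
  also have "\<dots> = A"
    using Inv_set_subset[of T \<theta> A] invariant_subset_Inv_set[OF invariant_attractor[OF A]] by blast
  finally show ?thesis .
qed

lemma omega_limit_attractor_Int:
  assumes "attractor T \<theta> A" and "attractor T \<theta> B"
  shows "omega_limit T \<theta> (A \<inter> B) = Inv_set T \<theta> (A \<inter> B)"
proof (rule omega_limit_forward_invariant)
  show "closed (A \<inter> B)"
    using assms by (intro closed_Int closed_attractor)
  fix t assume "t \<in> Tplus T"
  then have "\<theta> t ` A = A" "\<theta> t ` B = B"
    using assms invariant_attractor by (auto simp: invariant_set_def)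
  then show "\<theta> t ` (A \<inter> B) \<subseteq> A \<inter> B" by blast
qed

lemma attractor_Un:
  assumes "attractor T \<theta> A" and "attractor T \<theta> B"
  shows "attractor T \<theta> (A \<union> B)"
proof -
  obtain U where U: "attracting_nbhd T \<theta> U" "A = omega_limit T \<theta> U"
    using assms(1) by (rule attractorE)
  obtain V where V: "attracting_nbhd T \<theta> V" "B = omega_limit T \<theta> V"
    using assms(2) by (rule attractorE)
  have "A \<union> B = omega_limit T \<theta> (U \<union> V)"
    using U(2) V(2) by (simp add: omega_limit_Un)
  then show ?thesis
    using attracting_nbhd_Un[OF U(1) V(1)] unfolding attractor_def by blast
qed

lemma attractor_meet:
  assumes "attractor T \<theta> A" and "attractor T \<theta> B"
  shows "attractor T \<theta> (omega_limit T \<theta> (A \<inter> B))"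
proof -
  obtain U where U: "attracting_nbhd T \<theta> U" "A = omega_limit T \<theta> U"
    using assms(1) by (rule attractorE)
  obtain V where V: "attracting_nbhd T \<theta> V" "B = omega_limit T \<theta> V"
    using assms(2) by (rule attractorE)
  show ?thesis
    using omega_limit_Int[OF U(1) V(1)] attracting_nbhd_Int[OF U(1) V(1)] U(2) V(2)
    unfolding attractor_def by blast
qed

lemma Inv_set_UNIV: "Inv_set T \<theta> UNIV = omega_limit T \<theta> UNIV"
  using omega_limit_attracting_nbhd[OF attracting_nbhd_UNIV] by simp

text \<open>
  On attractors the meet is also the largest invariant subset of the intersection, which makes
  associativity a matter of monotonicity; distributivity comes from \<open>omega_limit_Un\<close>.
\<close>
lemma bounded_distrib_lattice_Att: "bounded_distrib_lattice (Att T \<theta>)"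
proof -
  have min: "attractor T \<theta> {}"
    unfolding attractor_def using time_facts(1)
    by (intro exI[of _ "{}"]) (simp add: attracting_nbhd_empty omega_limit_empty)
  have max: "attractor T \<theta> (Inv_set T \<theta> UNIV)"
    unfolding attractor_def
    by (intro exI[of _ UNIV]) (simp add: attracting_nbhd_UNIV Inv_set_UNIV)
  have meet_le: "omega_limit T \<theta> (A \<inter> B) \<subseteq> A" if "attractor T \<theta> A" for A B
    using omega_limit_mono[of "A \<inter> B" A] omega_limit_attractor[OF that] by auto
  have assoc: "omega_limit T \<theta> (A \<inter> omega_limit T \<theta> (B \<inter> C)) = Inv_set T \<theta> (A \<inter> B \<inter> C)"
    if A: "attractor T \<theta> A" and B: "attractor T \<theta> B" and C: "attractor T \<theta> C" for A B C
  proof -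
    have "omega_limit T \<theta> (A \<inter> omega_limit T \<theta> (B \<inter> C)) = Inv_set T \<theta> (A \<inter> Inv_set T \<theta> (B \<inter> C))"
      using omega_limit_attractor_Int[OF A attractor_meet[OF B C]] omega_limit_attractor_Int[OF B C]
      by simp
    also have "\<dots> = Inv_set T \<theta> (A \<inter> B \<inter> C)"
    proof
      show "Inv_set T \<theta> (A \<inter> Inv_set T \<theta> (B \<inter> C)) \<subseteq> Inv_set T \<theta> (A \<inter> B \<inter> C)"
        using Inv_set_subset[of T \<theta> "B \<inter> C"] by (intro Inv_set_mono) blast
      have "Inv_set T \<theta> (A \<inter> B \<inter> C) \<subseteq> A \<inter> Inv_set T \<theta> (B \<inter> C)"
        using Inv_set_subset[of T \<theta> "A \<inter> B \<inter> C"] Inv_set_mono[of "A \<inter> B \<inter> C" "B \<inter> C" T \<theta>] by blast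
      then show "Inv_set T \<theta> (A \<inter> B \<inter> C) \<subseteq> Inv_set T \<theta> (A \<inter> Inv_set T \<theta> (B \<inter> C))"
        by (rule invariant_subset_Inv_set[OF invariant_Inv_set])
    qed
    finally show ?thesis .
  qed
  have meet_assoc: "omega_limit T \<theta> (A \<inter> omega_limit T \<theta> (B \<inter> C)) =
      omega_limit T \<theta> (omega_limit T \<theta> (A \<inter> B) \<inter> C)"
    if "attractor T \<theta> A" "attractor T \<theta> B" "attractor T \<theta> C" for A B C
    using assoc[of A B C] assoc[of C A B] that by (simp add: Int_ac)
  have top: "omega_limit T \<theta> (Inv_set T \<theta> UNIV \<inter> A) = A" if "attractor T \<theta> A" for A
  proof -
    have "A \<subseteq> Inv_set T \<theta> UNIV"
      using invariant_subset_Inv_set[OF invariant_attractor[OF that]] by simp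
    then show ?thesis using omega_limit_attractor[OF that] by (simp add: Int_absorb1)
  qed
  show ?thesis
    unfolding bounded_distrib_lattice_def Att_def bdd_lat.simps mem_Collect_eq
  proof (intro conjI ballI; (unfold mem_Collect_eq)?)
    fix A B assume A: "attractor T \<theta> A" and B: "attractor T \<theta> B"
    show "A \<union> omega_limit T \<theta> (A \<inter> B) = A"
      using meet_le[OF A] by blast
    show "omega_limit T \<theta> (A \<inter> (A \<union> B)) = A"
      using omega_limit_attractor[OF A] by (simp add: Int_absorb2)
  next
    fix A B C assume "attractor T \<theta> A" "attractor T \<theta> B" "attractor T \<theta> C"
    then show "omega_limit T \<theta> (A \<inter> omega_limit T \<theta> (B \<inter> C)) =
        omega_limit T \<theta> (omega_limit T \<theta> (A \<inter> B) \<inter> C)"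
      by (rule meet_assoc)
  qed (simp_all only: min max attractor_Un attractor_meet top Un_empty_left Un_assoc
      Int_Un_distrib omega_limit_Un, simp_all add: Int_commute Un_commute)
qed

end

section \<open>Pulling back along a factor map\<close>

locale factor_map = base: compact_system T \<psi> + total: compact_system T \<Theta>
  for T and \<psi> :: "real \<Rightarrow> 'y::metric_space \<Rightarrow> 'y" and \<Theta> :: "real \<Rightarrow> 'z::metric_space \<Rightarrow> 'z" +
  fixes \<pi> :: "'z \<Rightarrow> 'y"
  assumes continuous_proj: "continuous_on UNIV \<pi>"
    and surj_proj: "surj \<pi>"
    and semiconjugacy: "t \<in> Tplus T \<Longrightarrow> \<pi> (\<Theta> t z) = \<psi> t (\<pi> z)"
begin

lemma attracting_nbhd_vimage:
  assumes "attracting_nbhd T \<psi> U"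
  shows "attracting_nbhd T \<Theta> (\<pi> -` U)"
proof -
  obtain \<tau> where \<tau>: "\<tau> \<in> T" "\<tau> > 0"
    and attr: "\<And>t. t \<in> T \<Longrightarrow> t \<ge> \<tau> \<Longrightarrow> \<psi> t ` closure U \<subseteq> interior U"
    using assms by (auto simp: attracting_nbhd_def)
  have cl: "closure (\<pi> -` U) \<subseteq> \<pi> -` closure U"
    using continuous_proj closure_subset by (intro closure_minimal closed_vimage) auto
  have int: "\<pi> -` interior U \<subseteq> interior (\<pi> -` U)"
    using continuous_proj interior_subset[of U] by (intro interior_maximal open_vimage) auto
  have "\<Theta> t ` closure (\<pi> -` U) \<subseteq> interior (\<pi> -` U)" if "t \<in> T" "t \<ge> \<tau>" for t
  proof -
    have "\<Theta> t ` closure (\<pi> -` U) \<subseteq> \<pi> -` interior U"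
      using cl attr[OF that] semiconjugacy[of t] that \<tau> by (fastforce simp: Tplus_def)
    then show ?thesis using int by blast
  qed
  then show ?thesis using \<tau> unfolding attracting_nbhd_def by blast
qed

lemma lattice_embedding_vimage: "lattice_embedding (ANbhd T \<psi>) (ANbhd T \<Theta>) (vimage \<pi>)"
proof -
  have "inj_on (vimage \<pi>) S" for S
    by (rule inj_on_inverseI[of _ "image \<pi>"]) (simp add: surj_image_vimage_eq surj_proj)
  then show ?thesis
    using base.bounded_distrib_lattice_ANbhd total.bounded_distrib_lattice_ANbhd
    by (auto simp: lattice_embedding_def lattice_homomorphism_def ANbhd_def attracting_nbhd_vimage)
qed

lemma invariant_image:
  assumes "invariant_set T \<Theta> S"
  shows "invariant_set T \<psi> (\<pi> ` S)"
  unfolding invariant_set_def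
proof
  fix t assume t: "t \<in> Tplus T"
  have "\<psi> t ` \<pi> ` S = \<pi> ` \<Theta> t ` S"
    by (simp add: image_image semiconjugacy[OF t])
  then show "\<psi> t ` \<pi> ` S = \<pi> ` S"
    using assms t by (simp add: invariant_set_def)
qed

lemma Inv_set_vimage: "Inv_set T \<Theta> (\<pi> -` Inv_set T \<psi> U) = Inv_set T \<Theta> (\<pi> -` U)"
proof
  show "Inv_set T \<Theta> (\<pi> -` Inv_set T \<psi> U) \<subseteq> Inv_set T \<Theta> (\<pi> -` U)"
    using Inv_set_subset by (intro Inv_set_mono vimage_mono)
  have "\<pi> ` Inv_set T \<Theta> (\<pi> -` U) \<subseteq> Inv_set T \<psi> U"
    using invariant_image[OF invariant_Inv_set] Inv_set_subset[of T \<Theta> "\<pi> -` U"]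
    by (intro invariant_subset_Inv_set) auto
  then show "Inv_set T \<Theta> (\<pi> -` U) \<subseteq> Inv_set T \<Theta> (\<pi> -` Inv_set T \<psi> U)"
    by (intro invariant_subset_Inv_set invariant_Inv_set) blast
qed

abbreviation lift :: "'y set \<Rightarrow> 'z set" where
  "lift A \<equiv> Inv_set T \<Theta> (\<pi> -` A)"

lemma lift_omega_limit:
  assumes "attracting_nbhd T \<psi> U"
  shows "lift (omega_limit T \<psi> U) = omega_limit T \<Theta> (\<pi> -` U)"
  using base.omega_limit_attracting_nbhd[OF assms] Inv_set_vimage
    total.omega_limit_attracting_nbhd[OF attracting_nbhd_vimage[OF assms]] by simp

text \<open>
  Given \<open>y \<in> A\<close> and a time \<open>n\<close>, invariance provides \<open>y' \<in> A\<close> with \<open>\<psi> n y' = y\<close>. A point over \<open>y'\<close> flows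
  in time \<open>n\<close> to a point over \<open>y\<close>, so the fibre over \<open>y\<close> meets every tail of the preimage of \<open>A\<close>.
\<close>
lemma image_lift:
  assumes "closed A" and inv: "invariant_set T \<psi> A"
  shows "\<pi> ` lift A = A"
proof
  show "\<pi> ` lift A \<subseteq> A"
    using Inv_set_subset[of T \<Theta> "\<pi> -` A"] by auto
  have "closed (\<pi> -` A)"
    using assms(1) continuous_proj by (rule closed_vimage)
  moreover have "\<Theta> t ` (\<pi> -` A) \<subseteq> \<pi> -` A" if "t \<in> Tplus T" for t
    using inv that semiconjugacy[OF that] by (auto simp: invariant_set_def)
  ultimately have lift: "omega_limit T \<Theta> (\<pi> -` A) = lift A"
    by (rule total.omega_limit_forward_invariant)
  show "A \<subseteq> \<pi> ` lift A"
  proof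
    fix y assume y: "y \<in> A"
    have "\<pi> -` {y} \<inter> omega_limit T \<Theta> (\<pi> -` A) \<noteq> {}"
    proof (rule total.omega_limit_meets_closed)
      show "closed (\<pi> -` {y})"
        using continuous_proj by (intro closed_vimage) auto
      fix n :: nat
      have n: "real n \<in> Tplus T"
        using base.time_facts by (simp add: Tplus_def)
      then have "y \<in> \<psi> (real n) ` A"
        using inv y by (simp add: invariant_set_def)
      then obtain y' where y': "y' \<in> A" "y = \<psi> (real n) y'" by blast
      obtain z where z: "y' = \<pi> z"
        using surj_proj by (rule surjE)
      have "\<Theta> (real n) z \<in> tail T \<Theta> (\<pi> -` A) (real n)"
        using y' z n by (force simp: tail_def Tplus_def)
      moreover have "\<pi> (\<Theta> (real n) z) = y"
        using semiconjugacy[OF n] y' z by simp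
      ultimately show "\<pi> -` {y} \<inter> closure (tail T \<Theta> (\<pi> -` A) (real n)) \<noteq> {}"
        using closure_subset by blast
    qed
    then show "y \<in> \<pi> ` lift A"
      unfolding lift by blast
  qed
qed

lemma image_lift_attractor: "attractor T \<psi> A \<Longrightarrow> \<pi> ` lift A = A"
  by (simp add: image_lift base.closed_attractor base.invariant_attractor)

lemma lattice_embedding_lift: "lattice_embedding (Att T \<psi>) (Att T \<Theta>) lift"
proof -
  have inj: "inj_on lift {A. attractor T \<psi> A}"
    by (rule inj_on_inverseI[of _ "image \<pi>"]) (simp add: image_lift_attractor)
  have attr: "attractor T \<Theta> (lift A)" if "attractor T \<psi> A" for A
    using that attracting_nbhd_vimage lift_omega_limit unfolding attractor_def by blast
  have ops: "lift (A \<union> B) = lift A \<union> lift B"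
    "lift (omega_limit T \<psi> (A \<inter> B)) = omega_limit T \<Theta> (lift A \<inter> lift B)"
    if "attractor T \<psi> A" "attractor T \<psi> B" for A B
  proof -
    obtain U where U: "attracting_nbhd T \<psi> U" "A = omega_limit T \<psi> U"
      using \<open>attractor T \<psi> A\<close> by (rule base.attractorE)
    obtain V where V: "attracting_nbhd T \<psi> V" "B = omega_limit T \<psi> V"
      using \<open>attractor T \<psi> B\<close> by (rule base.attractorE)
    have "lift (A \<union> B) = omega_limit T \<Theta> (\<pi> -` (U \<union> V))"
      using lift_omega_limit[OF attracting_nbhd_Un[OF U(1) V(1)]] U(2) V(2)
      by (simp add: omega_limit_Un)
    then show "lift (A \<union> B) = lift A \<union> lift B"
      using lift_omega_limit[OF U(1)] lift_omega_limit[OF V(1)] U(2) V(2)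
      by (simp add: omega_limit_Un)
    have "lift (omega_limit T \<psi> (A \<inter> B)) = omega_limit T \<Theta> (\<pi> -` U \<inter> \<pi> -` V)"
      using lift_omega_limit[OF attracting_nbhd_Int[OF U(1) V(1)]] U(2) V(2)
        base.omega_limit_Int[OF U(1) V(1)] by simp
    also have "\<dots> = omega_limit T \<Theta> (lift A \<inter> lift B)"
      using total.omega_limit_Int[OF attracting_nbhd_vimage[OF U(1)] attracting_nbhd_vimage[OF V(1)]]
        lift_omega_limit[OF U(1)] lift_omega_limit[OF V(1)] U(2) V(2) by simp
    finally show "lift (omega_limit T \<psi> (A \<inter> B)) = omega_limit T \<Theta> (lift A \<inter> lift B)" .
  qed
  have min: "lift {} = {}"
    using Inv_set_subset[of T \<Theta> "{}"] by simp
  have max: "lift (Inv_set T \<psi> UNIV) = Inv_set T \<Theta> UNIV"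
    using Inv_set_vimage[of UNIV] by simp
  show ?thesis
    unfolding lattice_embedding_def lattice_homomorphism_def
    using base.bounded_distrib_lattice_Att total.bounded_distrib_lattice_Att inj attr ops min max
    by (simp add: Att_def image_subset_iff)
qed

end

section \<open>Products and skew products\<close>

text \<open>A product is the skew product whose cocycle ignores the base point.\<close>
lemma product_or_skew_productE:
  assumes "product_or_skew_product T \<psi> \<Theta>"
  obtains \<phi> where "skew_cocycle T \<phi> \<psi>" and "\<Theta> = skew_product_system \<phi> \<psi>"
proof -
  have "\<exists>\<phi>'. skew_cocycle T \<phi>' \<psi> \<and> \<Theta> = skew_product_system \<phi>' \<psi>"
    if \<phi>: "dynamical_system T \<phi>" "\<Theta> = product_system \<phi> \<psi>" for \<phi>
  proof (intro exI conjI)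
    have "continuous_on (Tplus T \<times> UNIV) (\<lambda>(t, x). \<phi> t x)"
      using \<phi> by (simp add: dynamical_system_def)
    then have "continuous_on (Tplus T \<times> UNIV \<times> UNIV)
        (\<lambda>p. (\<lambda>(t, x). \<phi> t x) (fst p, fst (snd p)))"
      by (rule continuous_on_compose2) (auto intro!: continuous_intros)
    then show "skew_cocycle T (\<lambda>t x y. \<phi> t x) \<psi>"
      using \<phi> by (simp add: skew_cocycle_def dynamical_system_def case_prod_unfold)
    show "\<Theta> = skew_product_system (\<lambda>t x y. \<phi> t x) \<psi>"
      using \<phi> by (simp add: product_system_def skew_product_system_def fun_eq_iff)
  qed
  then show ?thesis
    using assms that unfolding product_or_skew_product_def by blast
qed

lemma dynamical_system_skew_product:
  fixes \<phi> :: "real \<Rightarrow> 'x::metric_space \<Rightarrow> 'y::metric_space \<Rightarrow> 'x"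
  assumes \<phi>: "skew_cocycle T \<phi> \<psi>" and \<psi>: "dynamical_system T \<psi>"
  shows "dynamical_system T (skew_product_system \<phi> \<psi>)"
proof -
  have fibre: "continuous_on (Tplus T \<times> UNIV \<times> UNIV) (\<lambda>(t, x, y). \<phi> t x y)"
    using \<phi> by (simp add: skew_cocycle_def)
  have "continuous_on (Tplus T \<times> UNIV) (\<lambda>(t, y). \<psi> t y)"
    using \<psi> by (simp add: dynamical_system_def)
  then have "continuous_on (Tplus T \<times> (UNIV :: 'x set) \<times> UNIV)
      (\<lambda>p. (\<lambda>(t, y). \<psi> t y) (fst p, snd (snd p)))"
    by (rule continuous_on_compose2) (auto intro!: continuous_intros)
  with fibre have "continuous_on (Tplus T \<times> UNIV \<times> UNIV)
      (\<lambda>p. ((\<lambda>(t, x, y). \<phi> t x y) p, (\<lambda>(t, y). \<psi> t y) (fst p, snd (snd p))))"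
    by (rule continuous_on_Pair)
  then have "continuous_on (Tplus T \<times> UNIV) (\<lambda>(t, z). skew_product_system \<phi> \<psi> t z)"
    by (simp add: skew_product_system_def case_prod_unfold)
  then show ?thesis
    using \<phi> \<psi> by (simp add: dynamical_system_def skew_cocycle_def skew_product_system_def)
qed

theorem proposition3p7:
  fixes T :: "real set"
    and \<psi> :: "real \<Rightarrow> 'y::metric_space \<Rightarrow> 'y"
    and \<Theta> :: "real \<Rightarrow> 'x::metric_space \<times> 'y \<Rightarrow> 'x \<times> 'y"
  assumes "T = \<int> \<or> T = UNIV"
    and "compact (UNIV :: 'x set)" and "compact (UNIV :: 'y set)"
    and "product_or_skew_product T \<psi> \<Theta>"
  shows "lattice_embedding (ANbhd T \<psi>) (ANbhd T \<Theta>) iota_hat \<and>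
     lattice_embedding (Att T \<psi>) (Att T \<Theta>) (iota T \<Theta>) \<and>
     (\<forall>U\<in>lcarrier (ANbhd T \<psi>). snd ` (iota_hat U :: ('x \<times> 'y) set) = U) \<and>
     (\<forall>A\<in>lcarrier (Att T \<psi>). snd ` iota T \<Theta> A = A)"
proof -
  obtain \<phi> where \<phi>: "skew_cocycle T \<phi> \<psi>" "\<Theta> = skew_product_system \<phi> \<psi>"
    using assms(4) by (rule product_or_skew_productE)
  have \<psi>: "dynamical_system T \<psi>"
    using assms(4) by (simp add: product_or_skew_product_def)
  have "compact (UNIV :: ('x \<times> 'y) set)"
    using compact_Times[OF assms(2,3)] by simp
  then interpret factor_map T \<psi> \<Theta> snd
    using assms \<psi> dynamical_system_skew_product[OF \<phi>(1) \<psi>] \<phi>(2)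
    by unfold_locales
      (auto intro!: continuous_intros simp: skew_product_system_def case_prod_unfold)
  have hat: "iota_hat = vimage (snd :: 'x \<times> 'y \<Rightarrow> 'y)"
    by (auto simp: iota_hat_def)
  have iota: "iota T \<Theta> = lift"
    by (auto simp: iota_def vimage_snd)
  show ?thesis
    unfolding hat iota
    using lattice_embedding_vimage lattice_embedding_lift image_lift_attractor
    by (simp add: Att_def surj_image_vimage_eq)
qed

end
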